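(* Let $F_1$ and $F_2$ be finite subsets of $\mathbb{Z}^2$ such that $F_1$ is uniquely determined by its row and column sums, $|F_1| = |F_2|$, and $F_1 \cap F_2 = \emptyset$. Let $2\alpha = \sum_{j\in\mathbb{Z}} |c_j^{(1)} - c_j^{(2)}| + \sum_{i\in\mathbb{Z}} |r_i^{(1)} - r_i^{(2)}|$. Then \[ |F_1| \le \sum_{i=1}^{\alpha} \left\lfloor \frac{\alpha}{i} \right\rfloor. \]
   Context: For $i \in \mathbb{Z}$, row $i$ is $\{(x,y)\in\mathbb{Z}^2 : x = i\}$ and for $j\in\mathbb{Z}$, column $j$ is $\{(x,y)\in\mathbb{Z}^2: y=j\}$. For $h\in\{1,2\}$, $r_i^{(h)}$ is the number of points of $F_h$ in row $i$ and $c_j^{(h)}$ the number of points of $F_h$ in column $j$. $F_1$ is uniquely determined by its row and column sums if no finite subset of $\mathbb{Z}^2$ other than $F_1$ has the same row sums and column sums. The total error in the line sums is always even, hence written $2\alpha$ with $\alpha$ a nonnegative integer. *)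

theory Defs
  imports Complex_Main "HOL-Library.Groups_Big_Fun"
begin

definition row :: "int \<Rightarrow> (int \<times> int) set" where
  "row i = {(x, y). x = i}"

definition column :: "int \<Rightarrow> (int \<times> int) set" where
  "column j = {(x, y). y = j}"

definition row_sum :: "(int \<times> int) set \<Rightarrow> int \<Rightarrow> nat" where
  "row_sum F i = card (F \<inter> row i)"

definition col_sum :: "(int \<times> int) set \<Rightarrow> int \<Rightarrow> nat" where
  "col_sum F j = card (F \<inter> column j)"

definition uniquely_determined :: "(int \<times> int) set \<Rightarrow> bool" where
  "uniquely_determined F \<longleftrightarrow>
     (\<forall>G. finite G \<and> (\<forall>i. row_sum G i = row_sum F i) \<and> (\<forall>j. col_sum G j = col_sum F j)
        \<longrightarrow> G = F)"

text \<open>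
  The sums range over all of the integers; \<^const>\<open>Sum_any\<close> is the sum over the support, which is
  finite here for finite sets (otherwise it would be 0 by convention).
\<close>

definition line_sum_error :: "(int \<times> int) set \<Rightarrow> (int \<times> int) set \<Rightarrow> int" where
  "line_sum_error F G =
     Sum_any (\<lambda>j. \<bar>int (col_sum F j) - int (col_sum G j)\<bar>) +
     Sum_any (\<lambda>i. \<bar>int (row_sum F i) - int (row_sum G i)\<bar>)"

lemma finite_row_col_support:
  assumes "finite F"
  shows "finite {i. row_sum F i \<noteq> 0}" "finite {j. col_sum F j \<noteq> 0}"
proof -
  have "{i. row_sum F i \<noteq> 0} \<subseteq> fst ` F"
    by (auto simp: row_sum_def row_def card_eq_0_iff image_iff) force
  then show "finite {i. row_sum F i \<noteq> 0}"
    using assms finite_surj by blast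
  have "{j. col_sum F j \<noteq> 0} \<subseteq> snd ` F"
    by (auto simp: col_sum_def column_def card_eq_0_iff image_iff) force
  then show "finite {j. col_sum F j \<noteq> 0}"
    using assms finite_surj by blast
qed

lemma sum_row_col_sums:
  assumes "finite F"
  shows "fst ` F \<subseteq> A \<Longrightarrow> finite A \<Longrightarrow> (\<Sum>i\<in>A. row_sum F i) = card F"
    and "snd ` F \<subseteq> A \<Longrightarrow> finite A \<Longrightarrow> (\<Sum>j\<in>A. col_sum F j) = card F"
proof -
  assume A: "fst ` F \<subseteq> A" "finite A"
  have "row_sum F i = card {p \<in> F. fst p = i}" for i
    unfolding row_sum_def row_def by (rule arg_cong[where f = card]) auto
  then show "(\<Sum>i\<in>A. row_sum F i) = card F"
    using sum.group[OF assms A(2,1), of "\<lambda>_. 1::nat"] by simp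
next
  assume A: "snd ` F \<subseteq> A" "finite A"
  have "col_sum F j = card {p \<in> F. snd p = j}" for j
    unfolding col_sum_def column_def by (rule arg_cong[where f = card]) auto
  then show "(\<Sum>j\<in>A. col_sum F j) = card F"
    using sum.group[OF assms A(2,1), of "\<lambda>_. 1::nat"] by simp
qed

lemma even_sum_abs_iff: "even (\<Sum>a\<in>A. \<bar>f a :: int\<bar>) \<longleftrightarrow> even (\<Sum>a\<in>A. f a)"
  by (induction A rule: infinite_finite_induct) auto

lemma line_sum_error_eq_double:
  assumes fin: "finite F" "finite G" and card: "card F = card G"
  obtains \<alpha> :: nat where "2 * int \<alpha> = line_sum_error F G"
proof -
  let ?A = "fst ` F \<union> fst ` G" and ?B = "snd ` F \<union> snd ` G"
  let ?r = "\<lambda>i. int (row_sum F i) - int (row_sum G i)"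
  let ?c = "\<lambda>j. int (col_sum F j) - int (col_sum G j)"
  have zero: "row_sum H i = 0" if "i \<notin> fst ` H" for H i
    using that unfolding row_sum_def row_def by (force simp: card_eq_0_iff)
  have zero': "col_sum H j = 0" if "j \<notin> snd ` H" for H j
    using that unfolding col_sum_def column_def by (force simp: card_eq_0_iff)
  have r: "Sum_any (\<lambda>i. \<bar>?r i\<bar>) = (\<Sum>i\<in>?A. \<bar>?r i\<bar>)"
    using fin zero[of _ F] zero[of _ G] by (intro Sum_any.expand_superset) force+
  have c: "Sum_any (\<lambda>j. \<bar>?c j\<bar>) = (\<Sum>j\<in>?B. \<bar>?c j\<bar>)"
    using fin zero'[of _ F] zero'[of _ G] by (intro Sum_any.expand_superset) force+
  have r0: "(\<Sum>i\<in>?A. ?r i) = 0"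
    using sum_row_col_sums(1)[OF fin(1), of ?A] sum_row_col_sums(1)[OF fin(2), of ?A] fin card
    by (simp add: sum_subtractf flip: of_nat_sum)
  have c0: "(\<Sum>j\<in>?B. ?c j) = 0"
    using sum_row_col_sums(2)[OF fin(1), of ?B] sum_row_col_sums(2)[OF fin(2), of ?B] fin card
    by (simp add: sum_subtractf flip: of_nat_sum)
  have "even (line_sum_error F G)"
    unfolding line_sum_error_def r c even_add even_sum_abs_iff r0 c0 by simp
  moreover have "line_sum_error F G \<ge> 0"
    unfolding line_sum_error_def r c by (simp add: sum_nonneg)
  ultimately have "2 * int (nat (line_sum_error F G div 2)) = line_sum_error F G"
    by simp
  then show thesis by (rule that)
qed

end

theory Submission
  imports Defs
begin

text \<open>
  A set determined by its row and column sums contains no switching component, so its rows are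
  nested as sets of columns. Given a row with \<open>m\<close> points, let \<open>J\<close> be its set of columns
  and \<open>I\<close> the set of all rows with at least \<open>m\<close> points. Then \<open>I \<times> J\<close> is contained in
  \<open>F\<^sub>1\<close>, and \<open>F\<^sub>1\<close> has no point in the product of the two complements. Weighting the line sum
  differences by \<open>1\<close> on \<open>I\<close> and \<open>J\<close> and by \<open>-1\<close> elsewhere gives \<open>\<bar>I\<bar> * m \<le> \<alpha>\<close>. Hence the
  \<open>i\<close>-th largest row sum is at most \<open>\<alpha> / i\<close>, and summing over \<open>i\<close> gives the bound.
\<close>

lemma card_replace:
  assumes "finite S" "a \<in> S" "b \<notin> S"
  shows "card (insert b (S - {a})) = card S"
  using assms by (metis DiffD1 card.remove card_insert_disjoint finite_Diff)

text \<open>If both other corners of the rectangle were missing, trading one diagonal for the other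
  would remove one point from and add one point to each of the two rows and two columns. All line
  sums would survive, contradicting uniqueness.\<close>

lemma uniquely_determined_no_switch:
  assumes "finite F" "uniquely_determined F"
    and in_F: "(x, y) \<in> F" "(x', y') \<in> F"
  shows "(x, y') \<in> F \<or> (x', y) \<in> F"
proof (rule ccontr)
  assume "\<not> ?thesis"
  then have out: "(x, y') \<notin> F" "(x', y) \<notin> F" by auto
  with in_F have ne: "x \<noteq> x'" "y \<noteq> y'" by auto
  define G where "G = F - {(x, y), (x', y')} \<union> {(x, y'), (x', y)}"
  have "row_sum G i = row_sum F i" for i
  proof -
    consider "i = x" | "i = x'" | "i \<noteq> x" "i \<noteq> x'" by blast
    then show ?thesis
    proof cases
      case 1
      have "G \<inter> row i = insert (x, y') (F \<inter> row i - {(x, y)})"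
        using ne 1 by (auto simp: G_def row_def)
      then show ?thesis
        using card_replace[of "F \<inter> row i" "(x, y)" "(x, y')"] assms out 1
        by (simp add: row_sum_def row_def)
    next
      case 2
      have "G \<inter> row i = insert (x', y) (F \<inter> row i - {(x', y')})"
        using ne 2 by (auto simp: G_def row_def)
      then show ?thesis
        using card_replace[of "F \<inter> row i" "(x', y')" "(x', y)"] assms out 2
        by (simp add: row_sum_def row_def)
    next
      case 3
      then have "G \<inter> row i = F \<inter> row i" by (auto simp: G_def row_def)
      then show ?thesis by (simp add: row_sum_def)
    qed
  qed
  moreover have "col_sum G j = col_sum F j" for j
  proof -
    consider "j = y" | "j = y'" | "j \<noteq> y" "j \<noteq> y'" by blast
    then show ?thesis
    proof cases
      case 1
      have "G \<inter> column j = insert (x', y) (F \<inter> column j - {(x, y)})"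
        using ne 1 by (auto simp: G_def column_def)
      then show ?thesis
        using card_replace[of "F \<inter> column j" "(x, y)" "(x', y)"] assms out 1
        by (simp add: col_sum_def column_def)
    next
      case 2
      have "G \<inter> column j = insert (x, y') (F \<inter> column j - {(x', y')})"
        using ne 2 by (auto simp: G_def column_def)
      then show ?thesis
        using card_replace[of "F \<inter> column j" "(x', y')" "(x, y')"] assms out 2
        by (simp add: col_sum_def column_def)
    next
      case 3
      then have "G \<inter> column j = F \<inter> column j" by (auto simp: G_def column_def)
      then show ?thesis by (simp add: col_sum_def)
    qed
  qed
  moreover have "finite G" using assms by (simp add: G_def)
  ultimately have "G = F" using assms(2) by (simp add: uniquely_determined_def)
  then show False using out by (auto simp: G_def)
qed

lemma row_sum_eq_card_Image: "row_sum F x = card (F `` {x})"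
proof -
  have "F \<inter> row x = Pair x ` (F `` {x})" by (auto simp: row_def)
  then show ?thesis by (simp add: row_sum_def card_image inj_on_def)
qed

lemma uniquely_determined_Image_mono:
  assumes "finite F" "uniquely_determined F" "row_sum F x \<le> row_sum F x'"
  shows "F `` {x} \<subseteq> F `` {x'}"
proof (rule ccontr)
  assume not_sub: "\<not> ?thesis"
  \<comment> \<open>Take a column \<open>y\<close> met by row \<open>x\<close> but not by row
    \<open>x'\<close>. For each \<open>y'\<close> met by row \<open>x'\<close>, the absence of a
    switch leaves only \<open>(x, y') \<in> F\<close>.\<close>
  then have "F `` {x'} \<subset> F `` {x}"
    using uniquely_determined_no_switch[OF assms(1,2)] by blast
  then have "card (F `` {x'}) < card (F `` {x})"
    using assms(1) by (intro psubset_card_mono finite_Image)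
  with assms(3) show False by (simp add: row_sum_eq_card_Image)
qed

lemma sum_weighted_row_sum:
  fixes u :: "int \<Rightarrow> int"
  assumes "finite F" "fst ` F \<subseteq> A" "finite A"
  shows "(\<Sum>x\<in>A. u x * int (row_sum F x)) = (\<Sum>p\<in>F. u (fst p))"
proof -
  have "row_sum F x = card {p \<in> F. fst p = x}" for x
    unfolding row_sum_def row_def by (rule arg_cong[where f = card]) auto
  then show ?thesis
    using sum.group[OF assms(1,3,2), of "\<lambda>p. u (fst p)"] by (simp add: mult.commute)
qed

lemma sum_weighted_col_sum:
  fixes v :: "int \<Rightarrow> int"
  assumes "finite F" "snd ` F \<subseteq> B" "finite B"
  shows "(\<Sum>y\<in>B. v y * int (col_sum F y)) = (\<Sum>p\<in>F. v (snd p))"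
proof -
  have "col_sum F y = card {p \<in> F. snd p = y}" for y
    unfolding col_sum_def column_def by (rule arg_cong[where f = card]) auto
  then show ?thesis
    using sum.group[OF assms(1,3,2), of "\<lambda>p. v (snd p)"] by (simp add: mult.commute)
qed

text \<open>Grouping points by rows and by columns turns the left side into the line sum differences
  weighted by \<open>u\<close> and \<open>v\<close>. A weight of absolute value at most 1 cannot
  push a term above the absolute difference.\<close>

lemma weighted_difference_le_line_sum_error:
  fixes u v :: "int \<Rightarrow> int"
  assumes fin: "finite F" "finite G"
    and u: "\<And>x. \<bar>u x\<bar> \<le> 1" and v: "\<And>y. \<bar>v y\<bar> \<le> 1"
  shows "(\<Sum>p\<in>F. u (fst p) + v (snd p)) - (\<Sum>p\<in>G. u (fst p) + v (snd p)) \<le> line_sum_error F G"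
proof -
  let ?A = "fst ` F \<union> fst ` G" and ?B = "snd ` F \<union> snd ` G"
  let ?r = "\<lambda>x. int (row_sum F x) - int (row_sum G x)"
  let ?c = "\<lambda>y. int (col_sum F y) - int (col_sum G y)"
  have zero: "row_sum H x = 0" if "x \<notin> fst ` H" for H x
    using that unfolding row_sum_def row_def by (force simp: card_eq_0_iff)
  have zero': "col_sum H y = 0" if "y \<notin> snd ` H" for H y
    using that unfolding col_sum_def column_def by (force simp: card_eq_0_iff)
  have r: "Sum_any (\<lambda>x. \<bar>?r x\<bar>) = (\<Sum>x\<in>?A. \<bar>?r x\<bar>)"
    using fin zero[of _ F] zero[of _ G] by (intro Sum_any.expand_superset) force+
  have c: "Sum_any (\<lambda>y. \<bar>?c y\<bar>) = (\<Sum>y\<in>?B. \<bar>?c y\<bar>)"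
    using fin zero'[of _ F] zero'[of _ G] by (intro Sum_any.expand_superset) force+
  have le: "w * d \<le> \<bar>d\<bar>" if "\<bar>w\<bar> \<le> 1" for w d :: int
    using mult_right_mono[OF that abs_ge_zero[of d]] abs_ge_self[of "w * d"] by (simp add: abs_mult)
  have "(\<Sum>x\<in>?A. u x * ?r x) + (\<Sum>y\<in>?B. v y * ?c y) \<le> line_sum_error F G"
    unfolding line_sum_error_def r c
    using sum_mono[of ?A "\<lambda>x. u x * ?r x" "\<lambda>x. \<bar>?r x\<bar>"]
      sum_mono[of ?B "\<lambda>y. v y * ?c y" "\<lambda>y. \<bar>?c y\<bar>"] le u v by (smt (verit))
  then show ?thesis
    using fin by (simp add: right_diff_distrib sum_subtractf sum.distrib
        sum_weighted_row_sum sum_weighted_col_sum)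
qed

lemma card_rows_ge_mult_row_sum_le:
  assumes fin: "finite F" "finite G" and uniq: "uniquely_determined F"
    and disj: "F \<inter> G = {}" and err: "2 * int \<alpha> = line_sum_error F G"
  shows "row_sum F x * card {x' \<in> fst ` F. row_sum F x \<le> row_sum F x'} \<le> \<alpha>"
proof -
  define I where "I = {x' \<in> fst ` F. row_sum F x \<le> row_sum F x'}"
  define J where "J = F `` {x}"
  define u :: "int \<Rightarrow> int" where "u = (\<lambda>x. if x \<in> I then 1 else -1)"
  define v :: "int \<Rightarrow> int" where "v = (\<lambda>y. if y \<in> J then 1 else -1)"
  have sub: "I \<times> J \<subseteq> F"
    using uniquely_determined_Image_mono[OF fin(1) uniq] by (fastforce simp: I_def J_def)
  \<comment> \<open>A point of \<open>F\<close> in a row outside \<open>I\<close> lies in a row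
    shorter than row \<open>x\<close>, so by nesting its column belongs to \<open>J\<close>.\<close>
  have cover: "p \<in> F \<Longrightarrow> fst p \<in> I \<or> snd p \<in> J" for p
    using uniquely_determined_Image_mono[OF fin(1) uniq, of "fst p" x]
    by (cases p) (force simp: I_def J_def)
  have "2 * int (card (I \<times> J)) = (\<Sum>p\<in>I \<times> J. 2)" by simp
  also have "\<dots> = (\<Sum>p\<in>F. if p \<in> I \<times> J then 2 else 0)"
    using sub fin by (simp add: sum.If_cases Int_absorb1)
  \<comment> \<open>The total weight of a point is 2 on \<open>I \<times> J\<close>, 0 if exactly
    one coordinate is selected, and -2 if neither is; \<open>cover\<close> excludes the last case on
    \<open>F\<close>.\<close>
  also have "\<dots> \<le> (\<Sum>p\<in>F. u (fst p) + v (snd p))"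
    using cover by (intro sum_mono) (auto simp: u_def v_def)
  also have "\<dots> \<le> line_sum_error F G + (\<Sum>p\<in>G. u (fst p) + v (snd p))"
  proof -
    have "\<bar>u x\<bar> \<le> 1" "\<bar>v x\<bar> \<le> 1" for x by (simp_all add: u_def v_def)
    from weighted_difference_le_line_sum_error[OF fin, of u v, OF this] show ?thesis by linarith
  qed
  \<comment> \<open>Being disjoint from \<open>F\<close>, the set \<open>G\<close> misses
    \<open>I \<times> J\<close>, so each of its points has a coordinate of weight -1.\<close>
  also have "(\<Sum>p\<in>G. u (fst p) + v (snd p)) \<le> 0"
    using disj sub by (intro sum_nonpos) (force simp: u_def v_def)
  finally have "card (I \<times> J) \<le> \<alpha>" using err by simp
  then show ?thesis
    by (simp add: card_cartesian_product I_def J_def row_sum_eq_card_Image mult.commute)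
qed

text \<open>Induction removes an element where \<open>f\<close> is minimal: it accounts for the last
  summand, and the ranks of the remaining elements do not grow, so they still satisfy the
  hypothesis.\<close>

lemma sum_le_sum_div_of_rank_bound:
  fixes f :: "'a \<Rightarrow> nat"
  assumes "finite A" "\<And>x. x \<in> A \<Longrightarrow> f x * card {y \<in> A. f x \<le> f y} \<le> n"
  shows "sum f A \<le> (\<Sum>i = 1..card A. n div i)"
  using assms
proof (induction "card A" arbitrary: A)
  case 0
  then show ?case by simp
next
  case (Suc k)
  then have "A \<noteq> {}" by auto
  then obtain x where x: "x \<in> A" "\<And>y. y \<in> A \<Longrightarrow> f x \<le> f y"
    using ex_min_if_finite[of "f ` A"] Suc.prems(1)
    by (metis (no_types, lifting) arg_min_if_finite(1) arg_min_least)
  let ?A = "A - {x}"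
  have k: "k = card ?A" using Suc.hyps(2) x(1) Suc.prems(1) by simp
  have "sum f ?A \<le> (\<Sum>i = 1..card ?A. n div i)"
  proof (rule Suc.hyps(1)[OF k])
    fix z assume "z \<in> ?A"
    have "card {y \<in> ?A. f z \<le> f y} \<le> card {y \<in> A. f z \<le> f y}"
      using Suc.prems(1) by (intro card_mono) auto
    then show "f z * card {y \<in> ?A. f z \<le> f y} \<le> n"
      using Suc.prems(2)[of z] \<open>z \<in> ?A\<close> by (meson DiffD1 le_trans mult_le_mono2)
  qed (use Suc.prems in simp)
  moreover have "f x \<le> n div Suc k"
  proof -
    \<comment> \<open>By minimality the rank of \<open>x\<close> is all of \<open>card A\<close>,
      that is \<open>Suc k\<close>.\<close>
    have "{y \<in> A. f x \<le> f y} = A" using x by auto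
    then have "f x * Suc k \<le> n" using Suc.prems(2)[OF x(1)] Suc.hyps(2) by simp
    then show ?thesis by (simp add: less_eq_div_iff_mult_less_eq)
  qed
  ultimately show ?case
    using sum.remove[OF Suc.prems(1) x(1), of f] k by (simp flip: Suc.hyps(2))
qed

text \<open>Summands with \<open>i > n\<close> vanish, so the number of occupied rows can be
  replaced by \<alpha> as the upper limit, whichever of the two is larger.\<close>

lemma sum_div_le:
  fixes m n :: nat
  shows "(\<Sum>i = 1..m. n div i) \<le> (\<Sum>i = 1..n. n div i)"
proof -
  have "(\<Sum>i = 1..m. n div i) = (\<Sum>i \<in> {1..m} \<inter> {1..n}. n div i)"
    by (rule sum.mono_neutral_right) auto
  also have "\<dots> \<le> (\<Sum>i = 1..n. n div i)"
    by (rule sum_mono2) auto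
  finally show ?thesis .
qed

theorem theorem4:
  fixes F\<^sub>1 F\<^sub>2 :: "(int \<times> int) set" and \<alpha> :: nat
  assumes "finite F\<^sub>1" and "finite F\<^sub>2"
    and "uniquely_determined F\<^sub>1"
    and "card F\<^sub>1 = card F\<^sub>2"
    and "F\<^sub>1 \<inter> F\<^sub>2 = {}"
    and "2 * int \<alpha> = line_sum_error F\<^sub>1 F\<^sub>2"
  shows "int (card F\<^sub>1) \<le> (\<Sum>i=1..\<alpha>. \<lfloor>real \<alpha> / real i\<rfloor>)"
proof -
  have "card F\<^sub>1 = (\<Sum>x\<in>fst ` F\<^sub>1. row_sum F\<^sub>1 x)"
    using sum_row_col_sums(1)[OF assms(1)] assms(1) by simp
  also have "\<dots> \<le> (\<Sum>i = 1..card (fst ` F\<^sub>1). \<alpha> div i)"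
    using card_rows_ge_mult_row_sum_le[OF assms(1,2,3,5,6)] assms(1)
    by (intro sum_le_sum_div_of_rank_bound) auto
  also have "\<dots> \<le> (\<Sum>i = 1..\<alpha>. \<alpha> div i)"
    by (rule sum_div_le)
  finally have "int (card F\<^sub>1) \<le> (\<Sum>i = 1..\<alpha>. int (\<alpha> div i))"
    by (simp flip: of_nat_sum)
  then show ?thesis
    by (simp add: floor_divide_of_nat_eq)
qed

end
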